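(* Let $s\ge 0$ and $n \geq 3s+1$ be integers. Then $$T_n^{(s)}(x)=\sum_{i=0}^s \sum_{j=0}^{s-i} \binom{s}{i,j,s-i-j}x^{2s-i-2j}\,T_{n-s-i-2j}^{(s-i-j)}(x).$$
   Context: For integers $m\ge 0$ and $0\le s\le \lfloor m/2\rfloor$, the incomplete tribonacci polynomial is defined by $$T_{m+1}^{(s)}(x)=\sum_{i=0}^{s}\sum_{j=0}^i \binom{i}{j}\binom{m-i-j}{i}x^{2m-3(i+j)}.$$ The trinomial coefficient is $\binom{s}{i,j,s-i-j}=\frac{s!}{i!\,j!\,(s-i-j)!}$. *)

theory Defs
  imports "HOL-Computational_Algebra.Polynomial"
begin

(* Indexed as T_{m+1}^{(s)}, intended for s \<le> m div 2; the value at index 0 is unspecified.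
   In that range i + j \<le> m, so m - i - j does not truncate.  The exponent 2 * m - 3 * (i + j)
   truncates only when 2 * i + j > m, where (m - i - j) choose i = 0. *)
primrec inc_tribonacci :: "nat \<Rightarrow> nat \<Rightarrow> int poly" where
  "inc_tribonacci (Suc m) s =
     (\<Sum>i = 0..s. \<Sum>j = 0..i.
        monom (int ((i choose j) * ((m - i - j) choose i))) (2 * m - 3 * (i + j)))"

(* The division is exact whenever i + j \<le> s. *)
definition trinomial :: "nat \<Rightarrow> nat \<Rightarrow> nat \<Rightarrow> nat" where
  "trinomial s i j = fact s div (fact i * fact j * fact (s - i - j))"

end

theory Submission
  imports Defs
begin

text \<open>
  The sums satisfy the recurrence of the tribonacci polynomials in an incomplete form
  (lemma \<open>inc_tribonacci_rec\<close>), where the superscript drops by one in the last two terms: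
  \<open>T_n^(s+1) = x^2 T_(n-1)^(s+1) + x T_(n-2)^(s) + T_(n-3)^(s)\<close>.
  Unfolding it \<open>r\<close> times gives one term for each word of length \<open>r\<close> in the
  three choices.  A word with \<open>i\<close> choices of the second kind and \<open>j\<close> of the third
  contributes \<open>x^(2r-i-2j) T_(n-r-i-2j)^(s-i-j)\<close>, and the trinomial coefficient counts
  these words; \<open>r = s\<close> is the theorem.

  The word count is arranged in two stages: first choose the \<open>p = i + j\<close> positions at which
  the superscript drops, then the \<open>j\<close> of these that are of the third kind.  The trinomial
  coefficient thereby factors as \<open>(r choose p) * (p choose j)\<close>.  The definition of the
  incomplete polynomials carries the same factor \<open>i choose j\<close>, so a single
  Pascal-type lemma (\<open>sum_choose_Suc\<close>) serves for the recurrence and for both stages of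
  its iteration.

  The index conditions guarantee that natural subtraction stays exact, except inside monomials
  whose binomial coefficient vanishes.
\<close>

text \<open>Pascal's rule in summed form: a choice among \<open>n + 1\<close> positions is a choice
  among the first \<open>n\<close>, and the last position either leaves the count alone or raises it.\<close>

lemma sum_choose_Suc:
  fixes f :: "nat \<Rightarrow> 'a::comm_semiring_1"
  shows "(\<Sum>j\<le>Suc n. of_nat (Suc n choose j) * f j)
       = (\<Sum>j\<le>n. of_nat (n choose j) * (f j + f (Suc j)))"
proof -
  have "(\<Sum>j\<le>Suc n. of_nat (Suc n choose j) * f j)
      = f 0 + (\<Sum>j\<le>n. of_nat (n choose Suc j) * f (Suc j))
        + (\<Sum>j\<le>n. of_nat (n choose j) * f (Suc j))"
    by (simp only: sum.atMost_Suc_shift) (simp add: sum.distrib algebra_simps)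
  also have "f 0 + (\<Sum>j\<le>n. of_nat (n choose Suc j) * f (Suc j))
      = (\<Sum>j\<le>Suc n. of_nat (n choose j) * f j)"
    by (simp only: sum.atMost_Suc_shift) simp
  also have "\<dots> = (\<Sum>j\<le>n. of_nat (n choose j) * f j)"
    by (simp add: binomial_eq_0)
  finally show ?thesis
    by (simp add: sum.distrib algebra_simps)
qed

text \<open>The factor \<open>i choose j\<close> is left out, so that the sum over \<open>j\<close> has the shape
  to which \<open>sum_choose_Suc\<close> applies.\<close>

definition tri_term :: "nat \<Rightarrow> nat \<Rightarrow> nat \<Rightarrow> int poly" where
  "tri_term m i j = monom (int ((m - i - j) choose i)) (2 * m - 3 * (i + j))"

lemma inc_tribonacci_tri_term:
  "inc_tribonacci (Suc m) s = (\<Sum>i\<le>s. \<Sum>j\<le>i. of_nat (i choose j) * tri_term m i j)"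
  by (simp add: tri_term_def atLeast0AtMost of_nat_poly smult_monom)

text \<open>For \<open>j \<le> i\<close> a nonzero binomial coefficient gives \<open>2 * i + j \<le> m\<close>, which
  keeps the exponent from being truncated; so multiplication by a power of \<open>x\<close> shifts it.\<close>

lemma monom_mult_tri_term:
  assumes "j \<le> i" "i + j \<le> m"
  shows "monom 1 d * tri_term m i j
       = monom (int ((m - i - j) choose i)) (2 * m + d - 3 * (i + j))"
proof (cases "2 * i + j \<le> m")
  case True
  with assms have "d + (2 * m - 3 * (i + j)) = 2 * m + d - 3 * (i + j)"
    by simp
  then show ?thesis
    by (simp add: tri_term_def mult_monom)
next
  case False
  with assms have "(m - i - j) choose i = 0"
    by (intro binomial_eq_0) simp
  then show ?thesis
    by (simp only: tri_term_def) simp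
qed

lemma sum_tri_term_Suc:
  assumes "2 * i \<le> k"
  shows "(\<Sum>j\<le>Suc i. of_nat (Suc i choose j) * tri_term (k + 3) (Suc i) j)
       = monom 1 2 * (\<Sum>j\<le>Suc i. of_nat (Suc i choose j) * tri_term (k + 2) (Suc i) j)
         + (\<Sum>j\<le>i. of_nat (i choose j) * (monom 1 1 * tri_term (k + 1) i j + tri_term k i j))"
proof -
  \<comment> \<open>The second part of Pascal's rule for \<open>(k + 2 - i - j) choose Suc i\<close>.  Splitting
      its weight \<open>Suc i choose j\<close> leaves \<open>D j + D (Suc j)\<close> with weight
      \<open>i choose j\<close>, and these are the two terms of lower superscript.\<close>
  define D where "D j = monom (int ((k + 1 - i - j) choose i)) (2 * k + 3 - 3 * (i + j))" for j
  have pascal: "tri_term (k + 3) (Suc i) j = monom 1 2 * tri_term (k + 2) (Suc i) j + D j"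
    if "j \<le> Suc i" for j
  proof -
    have idx: "k + 3 - Suc i - j = Suc (k + 1 - i - j)"
      "2 * (k + 3) - 3 * (Suc i + j) = 2 * k + 3 - 3 * (i + j)"
      using assms that by simp_all
    have "k + 2 - Suc i - j = k + 1 - i - j" "Suc i + j \<le> k + 2"
      "2 * (k + 2) + 2 - 3 * (Suc i + j) = 2 * k + 3 - 3 * (i + j)"
      using assms that by simp_all
    with that have "monom 1 2 * tri_term (k + 2) (Suc i) j
        = monom (int ((k + 1 - i - j) choose Suc i)) (2 * k + 3 - 3 * (i + j))"
      by (simp only: monom_mult_tri_term)
    then show ?thesis
      unfolding D_def tri_term_def[of "k + 3"] idx by (simp add: add_monom add.commute)
  qed
  have D: "D j = monom 1 1 * tri_term (k + 1) i j" "D (Suc j) = tri_term k i j"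
    if "j \<le> i" for j
  proof -
    have "i + j \<le> k + 1" "2 * (k + 1) + 1 - 3 * (i + j) = 2 * k + 3 - 3 * (i + j)"
      using assms that by simp_all
    with that show "D j = monom 1 1 * tri_term (k + 1) i j"
      by (simp only: D_def monom_mult_tri_term)
    have "2 * k + 3 - 3 * (i + Suc j) = 2 * k - 3 * (i + j)"
      by simp
    then show "D (Suc j) = tri_term k i j"
      by (simp only: D_def tri_term_def) simp
  qed
  have "(\<Sum>j\<le>Suc i. of_nat (Suc i choose j) * tri_term (k + 3) (Suc i) j)
      = monom 1 2 * (\<Sum>j\<le>Suc i. of_nat (Suc i choose j) * tri_term (k + 2) (Suc i) j)
        + (\<Sum>j\<le>Suc i. of_nat (Suc i choose j) * D j)"
    unfolding sum_distrib_left sum.distrib[symmetric]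
    by (intro sum.cong refl) (simp add: pascal algebra_simps del: binomial_Suc_Suc)
  also have "(\<Sum>j\<le>Suc i. of_nat (Suc i choose j) * D j)
      = (\<Sum>j\<le>i. of_nat (i choose j) * (monom 1 1 * tri_term (k + 1) i j + tri_term k i j))"
    unfolding sum_choose_Suc by (intro sum.cong refl) (simp add: D)
  finally show ?thesis .
qed

lemma inc_tribonacci_rec:
  assumes "2 * s \<le> k"
  shows "inc_tribonacci (k + 4) (Suc s)
       = monom 1 2 * inc_tribonacci (k + 3) (Suc s) + monom 1 1 * inc_tribonacci (k + 2) s
         + inc_tribonacci (k + 1) s"
proof -
  define S where "S m i = (\<Sum>j\<le>i. of_nat (i choose j) * tri_term m i j)" for m i
  have inc: "inc_tribonacci (Suc m) t = (\<Sum>i\<le>t. S m i)" for m t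
    by (simp only: inc_tribonacci_tri_term S_def)
  have zero: "S (k + 3) 0 = monom 1 2 * S (k + 2) 0"
    by (simp add: S_def tri_term_def mult_monom numeral_eq_Suc)
  have suc: "S (k + 3) (Suc i) = monom 1 2 * S (k + 2) (Suc i) + (monom 1 1 * S (k + 1) i + S k i)"
    if "i \<le> s" for i
  proof -
    have "2 * i \<le> k"
      using assms that by simp
    from sum_tri_term_Suc[OF this] show ?thesis
      unfolding S_def by (simp only: sum_distrib_left sum.distrib algebra_simps)
  qed
  have "inc_tribonacci (Suc (k + 3)) (Suc s)
      = monom 1 2 * S (k + 2) 0
        + (\<Sum>i\<le>s. monom 1 2 * S (k + 2) (Suc i) + (monom 1 1 * S (k + 1) i + S k i))"
    unfolding inc sum.atMost_Suc_shift zero by (simp add: suc)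
  also have "\<dots> = monom 1 2 * inc_tribonacci (Suc (k + 2)) (Suc s)
      + monom 1 1 * inc_tribonacci (Suc (k + 1)) s + inc_tribonacci (Suc k) s"
    unfolding inc sum.atMost_Suc_shift
    by (simp only: sum.distrib sum_distrib_left algebra_simps)
  finally show ?thesis
    by (simp add: eval_nat_numeral)
qed

text \<open>Separating the number \<open>r\<close> of unfoldings from the superscript \<open>s\<close> is what makes
  the induction possible.  Each unfolding lowers the index by at most two for every unit lost
  from \<open>s\<close>, and by one more, so the bound \<open>2 * s + r < n\<close> keeps every
  intermediate polynomial in the range where the recurrence holds.\<close>

lemma inc_tribonacci_iterate:
  assumes "r \<le> s" "2 * s + r < n"
  shows "inc_tribonacci n s =
    (\<Sum>p\<le>r. of_nat (r choose p) * (\<Sum>j\<le>p. of_nat (p choose j) *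
       (monom 1 (2 * r - p - j) * inc_tribonacci (n - r - p - j) (s - p))))"
  using assms
proof (induction r)
  case 0
  then show ?case
    by (simp flip: one_pCons add: monom_0)
next
  case (Suc r)
  define V where
    "V r p j = monom 1 (2 * r - p - j) * inc_tribonacci (n - r - p - j) (s - p)" for r p j
  have unfold_once: "V r p j = V (Suc r) p j + (V (Suc r) (Suc p) j + V (Suc r) (Suc p) (Suc j))"
    if "p \<le> r" "j \<le> p" for p j
  proof -
    define k t where "k = n - r - p - j - 4" and "t = s - Suc p"
    have "p < s"
      using Suc.prems that by simp
    then have s: "s - p = Suc t" "s - Suc p = t"
      by (simp_all add: t_def)
    have n: "n - r - p - j = k + 4" "n - Suc r - p - j = k + 3"
      "n - Suc r - Suc p - j = k + 2" "n - Suc r - Suc p - Suc j = k + 1"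
      using Suc.prems that by (simp_all add: k_def)
    have e: "2 * Suc r - p - j = (2 * r - p - j) + 2"
      "2 * Suc r - Suc p - j = (2 * r - p - j) + 1"
      "2 * Suc r - Suc p - Suc j = 2 * r - p - j"
      using that by simp_all
    have "2 * t \<le> k"
      using Suc.prems that by (simp add: k_def t_def)
    moreover have "monom 1 (a + d) = (monom 1 a * monom 1 d :: int poly)" for a d
      by (simp add: mult_monom)
    ultimately show ?thesis
      unfolding V_def s n e by (simp only: inc_tribonacci_rec algebra_simps)
  qed
  have "inc_tribonacci n s
      = (\<Sum>p\<le>r. of_nat (r choose p) * (\<Sum>j\<le>p. of_nat (p choose j) * V r p j))"
    using Suc unfolding V_def by simp
  also have "\<dots> = (\<Sum>p\<le>r. of_nat (r choose p) *
      ((\<Sum>j\<le>p. of_nat (p choose j) * V (Suc r) p j)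
       + (\<Sum>j\<le>p. of_nat (p choose j) * (V (Suc r) (Suc p) j + V (Suc r) (Suc p) (Suc j)))))"
    unfolding sum.distrib[symmetric] distrib_left[symmetric]
    by (intro sum.cong refl arg_cong2[where f = "(*)"]) (simp add: unfold_once)
  also have "\<dots> = (\<Sum>p\<le>Suc r. of_nat (Suc r choose p) *
      (\<Sum>j\<le>p. of_nat (p choose j) * V (Suc r) p j))"
    unfolding sum_choose_Suc ..
  finally show ?case
    unfolding V_def .
qed

lemma trinomial_eq_choose_mult:
  assumes "j \<le> p" "p \<le> s"
  shows "trinomial s (p - j) j = (s choose p) * (p choose j)"
proof -
  have "fact s = (s choose p) * (p choose j) * (fact (p - j) * fact j * fact (s - p))"
    using binomial_fact_lemma[OF assms(2)] binomial_fact_lemma[OF assms(1)]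
    by (metis mult.assoc mult.commute)
  then show ?thesis
    using assms by (simp add: trinomial_def)
qed

theorem mainTheorem5:
  fixes s n :: nat
  assumes "n \<ge> 3 * s + 1"
  shows "inc_tribonacci n s =
    (\<Sum>i = 0..s. \<Sum>j = 0..s - i.
       of_nat (trinomial s i j) * monom 1 (2 * s - i - 2 * j)
         * inc_tribonacci (n - s - i - 2 * j) (s - i - j))"
proof -
  define g where "g i j = of_nat (trinomial s i j) * monom 1 (2 * s - i - 2 * j)
      * inc_tribonacci (n - s - i - 2 * j) (s - i - j)" for i j
  have "(\<Sum>i = 0..s. \<Sum>j = 0..s - i. g i j) = (\<Sum>(j, i) \<in> {(j, i). j + i \<le> s}. g i j)"
    by (subst sum.Sigma) 
       (auto intro!: sum.reindex_bij_witness[where i = prod.swap and j = prod.swap])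
  also have "\<dots> = (\<Sum>p\<le>s. \<Sum>j\<le>p. g (p - j) j)"
    by (rule sum.triangle_reindex_eq)
  also have "\<dots> = (\<Sum>p\<le>s. of_nat (s choose p) * (\<Sum>j\<le>p. of_nat (p choose j) *
       (monom 1 (2 * s - p - j) * inc_tribonacci (n - s - p - j) (s - p))))"
    unfolding sum_distrib_left
  proof (intro sum.cong refl)
    fix p j assume "p \<in> {..s}" "j \<in> {..p}"
    then have le: "j \<le> p" "p \<le> s"
      by simp_all
    then have "2 * s - (p - j) - 2 * j = 2 * s - p - j"
      "n - s - (p - j) - 2 * j = n - s - p - j" "s - (p - j) - j = s - p"
      by simp_all
    then show "g (p - j) j = of_nat (s choose p) * (of_nat (p choose j) *
       (monom 1 (2 * s - p - j) * inc_tribonacci (n - s - p - j) (s - p)))"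
      unfolding g_def by (simp only: trinomial_eq_choose_mult[OF le] of_nat_mult mult.assoc)
  qed
  also have "\<dots> = inc_tribonacci n s"
    using assms by (intro inc_tribonacci_iterate[symmetric]) simp_all
  finally show ?thesis
    unfolding g_def ..
qed

end
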